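(* Let $(X,d)$ be a metric space, let $m\in X$, and let $\phi:X\times X\to\mathbb{R}$ be a nonnegative symmetric function. If $(X,d^{\phi,m})$ is totally bounded, then the completion of the metric space $(X,d^{\phi,m})$ is a compactification of $(X,d)$.
   Context: For $x,y\in X$ put $$\delta^{\phi,m}(x,y)=\min\left\{ d(x,y),\ \frac{1}{1+d(m,x)}+\phi(x,y)+\frac{1}{1+d(m,y)}\right\}.$$ For $n\in\mathbb{N}=\{1,2,\dots\}$ let $\Gamma^n_{x,y}$ be the set of all tuples $(x_0,\dots,x_n)$ of points of $X$ with $x_0=x$ and $x_n=y$, and let $\Gamma_{x,y}=\bigcup_{n\in\mathbb{N}}\Gamma^n_{x,y}$. Define $$d^{\phi,m}(x,y)=\inf\left\{\sum_{i=1}^n\delta^{\phi,m}(x_{i-1},x_i)\ :\ (x_0,\dots,x_n)\in\Gamma_{x,y},\ n\in\mathbb{N}\right\}.$$ "Symmetric" means $\phi(x,y)=\phi(y,x)$ for all $x,y\in X$. The function $d^{\phi,m}$ is a metric on $X$. A compactification of a topological space $X$ is a compact Hausdorff space $Y$ containing $X$ as a (topological) subspace such that $\overline{X}=Y$. Here $X$ carries the topology of $d$, and $X$ is regarded as a subset of the completion by identifying $x\in X$ with the class of the constant Cauchy sequence $\{x\}$. *)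

theory Defs
  imports "HOL-Analysis.Analysis"
begin

context Metric_space
begin

definition delta_phi :: "('a \<Rightarrow> 'a \<Rightarrow> real) \<Rightarrow> 'a \<Rightarrow> 'a \<Rightarrow> 'a \<Rightarrow> real"
  where "delta_phi \<phi> m x y = min (d x y) (1 / (1 + d m x) + \<phi> x y + 1 / (1 + d m y))"

text \<open>A tuple of \<open>n + 1\<close> points is a function on \<open>{..n}\<close>; its values beyond \<open>n\<close> are irrelevant.\<close>

definition chains :: "nat \<Rightarrow> 'a \<Rightarrow> 'a \<Rightarrow> (nat \<Rightarrow> 'a) set"
  where "chains n x y = {c \<in> {..n} \<rightarrow> M. c 0 = x \<and> c n = y}"

text \<open>The locale requires a distance to be nonnegative and symmetric on the whole type, not
  just on the carrier; hence the value \<open>0\<close> off the carrier, here and in \<open>completion_dist\<close>.\<close>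

definition dist_phi :: "('a \<Rightarrow> 'a \<Rightarrow> real) \<Rightarrow> 'a \<Rightarrow> 'a \<Rightarrow> 'a \<Rightarrow> real"
  where "dist_phi \<phi> m x y =
    (if x \<in> M \<and> y \<in> M
     then Inf {\<Sum>i=1..n. delta_phi \<phi> m (c (i - 1)) (c i) | n c. 1 \<le> n \<and> c \<in> chains n x y}
     else 0)"

definition Cauchy_equiv :: "((nat \<Rightarrow> 'a) \<times> (nat \<Rightarrow> 'a)) set"
  where "Cauchy_equiv =
    {(\<sigma>, \<tau>). MCauchy \<sigma> \<and> MCauchy \<tau> \<and> (\<lambda>n. d (\<sigma> n) (\<tau> n)) \<longlonglongrightarrow> 0}"

definition completion_carrier :: "(nat \<Rightarrow> 'a) set set"
  where "completion_carrier = {\<sigma>. MCauchy \<sigma>} // Cauchy_equiv"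

definition completion_dist :: "(nat \<Rightarrow> 'a) set \<Rightarrow> (nat \<Rightarrow> 'a) set \<Rightarrow> real"
  where "completion_dist A B =
    (if A \<in> completion_carrier \<and> B \<in> completion_carrier
     then THE r. \<forall>\<sigma>\<in>A. \<forall>\<tau>\<in>B. (\<lambda>n. d (\<sigma> n) (\<tau> n)) \<longlonglongrightarrow> r
     else 0)"

definition completion_emb :: "'a \<Rightarrow> (nat \<Rightarrow> 'a) set"
  where "completion_emb x = Cauchy_equiv `` {\<lambda>_. x}"

end

text \<open>\<open>Y\<close> is a compactification of \<open>X\<close>, where \<open>X\<close> is regarded as a subspace of \<open>Y\<close> along \<open>i\<close>.\<close>

definition compactification_via :: "'a topology \<Rightarrow> 'b topology \<Rightarrow> ('a \<Rightarrow> 'b) \<Rightarrow> bool"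
  where "compactification_via X Y i \<longleftrightarrow>
    compact_space Y \<and> Hausdorff_space Y \<and> embedding_map X Y i \<and>
    Y closure_of (i ` topspace X) = topspace Y"


text \<open>Both constructions yield metric spaces, so the notions of the locale apply to them.\<close>

context Metric_space
begin

lemma Metric_space_dist_phi:
  assumes m: "m \<in> M"
    and pos: "\<And>x y. \<lbrakk>x \<in> M; y \<in> M\<rbrakk> \<Longrightarrow> 0 \<le> \<phi> x y"
    and sym: "\<And>x y. \<lbrakk>x \<in> M; y \<in> M\<rbrakk> \<Longrightarrow> \<phi> x y = \<phi> y x"
  shows "Metric_space M (dist_phi \<phi> m)"
proof -
  let ?\<delta> = "delta_phi \<phi> m"
  define S where "S x y = {\<Sum>i=1..n. ?\<delta> (c (i - 1)) (c i) | n c. 1 \<le> n \<and> c \<in> chains n x y}" for x y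
  have SI: "(\<Sum>i=1..n. ?\<delta> (c (i - 1)) (c i)) \<in> S x y" if "1 \<le> n" "c \<in> chains n x y" for n c x y
    using that unfolding S_def by blast
  have eq: "dist_phi \<phi> m x y = Inf (S x y)" if "x \<in> M" "y \<in> M" for x y
    using that by (simp add: dist_phi_def S_def)
  have dpos: "0 \<le> ?\<delta> x y" if "x \<in> M" "y \<in> M" for x y
    using pos[OF that] by (auto simp: delta_phi_def)
  have dsym: "?\<delta> x y = ?\<delta> y x" if "x \<in> M" "y \<in> M" for x y
    using sym[OF that] by (simp add: delta_phi_def commute add_ac)
  have d0: "?\<delta> x x = 0" if "x \<in> M" for x
    using that pos[OF that that] by (simp add: delta_phi_def)
  have bnd: "min (d x (c k)) (1 / (1 + d m x)) \<le> (\<Sum>i=1..k. ?\<delta> (c (i - 1)) (c i))"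
    if "c \<in> {..k} \<rightarrow> M" "c 0 = x" for c x and k :: nat
    using that
  proof (induction k)
    case 0
    then show ?case by auto
  next
    case (Suc k)
    let ?s = "\<lambda>k. \<Sum>i=1..k. ?\<delta> (c (i - 1)) (c i)"
    have M: "x \<in> M" "c k \<in> M" "c (Suc k) \<in> M" using Suc.prems by auto
    have "c \<in> {..k} \<rightarrow> M" using Suc.prems(1) by auto
    then have IH: "min (d x (c k)) (1 / (1 + d m x)) \<le> ?s k" using Suc.IH Suc.prems(2) by blast
    have st: "?s (Suc k) = ?s k + ?\<delta> (c k) (c (Suc k))" by simp
    show ?case
    proof (cases "1 / (1 + d m x) \<le> ?s k")
      case True
      then show ?thesis using st dpos[OF M(2,3)] by linarith
    next
      case False
      then have le: "d x (c k) \<le> ?s k" using IH by linarith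
      show ?thesis
      proof (cases "?\<delta> (c k) (c (Suc k)) = d (c k) (c (Suc k))")
        case True
        then show ?thesis using st le triangle[OF M] by linarith
      next
        case False
        then have "?\<delta> (c k) (c (Suc k)) =
            1 / (1 + d m (c k)) + \<phi> (c k) (c (Suc k)) + 1 / (1 + d m (c (Suc k)))"
          unfolding delta_phi_def by linarith
        moreover have "0 \<le> 1 / (1 + d m (c (Suc k)))" by simp
        ultimately have "1 / (1 + d m (c k)) \<le> ?\<delta> (c k) (c (Suc k))"
          using pos[OF M(2,3)] by linarith
        moreover have "1 / (1 + d m x) \<le> d x (c k) + 1 / (1 + d m (c k))"
        proof -
          define a b t where "a = d m x" and "b = d m (c k)" and "t = d x (c k)"
          have ab: "0 \<le> a" "0 \<le> b" "0 \<le> t" "b \<le> a + t"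
            using triangle[OF m M(1,2)] by (auto simp: a_def b_def t_def)
          have "1 * 1 \<le> (1 + a) * (1 + b)" using ab by (intro mult_mono) auto
          then have "t * 1 \<le> t * ((1 + a) * (1 + b))"
            using ab(3) by (intro mult_left_mono) auto
          then have "1 + b \<le> t * ((1 + a) * (1 + b)) + (1 + a)" using ab by linarith
          then have "1 / (1 + a) \<le> t + 1 / (1 + b)"
            using ab by (simp add: field_simps)
          then show ?thesis by (simp add: a_def b_def t_def)
        qed
        ultimately show ?thesis using st le by linarith
      qed
    qed
  qed
  have Snn: "0 \<le> s" if s: "s \<in> S x y" for s x y
  proof -
    obtain n c where nc: "s = (\<Sum>i=1..n. ?\<delta> (c (i - 1)) (c i))" "c \<in> chains n x y"
      using s unfolding S_def by blast
    show ?thesis unfolding nc(1)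
      using nc(2) by (intro sum_nonneg dpos) (auto simp: chains_def)
  qed
  have bdd: "bdd_below (S x y)" for x y
    using Snn by (intro bdd_belowI[of _ 0]) auto
  have Sd: "?\<delta> x y \<in> S x y" if "x \<in> M" "y \<in> M" for x y
    unfolding S_def
    by (rule CollectI, rule exI[of _ 1], rule exI[of _ "\<lambda>i. if i = 0 then x else y"])
      (use that in \<open>auto simp: chains_def\<close>)
  then have ne: "S x y \<noteq> {}" if "x \<in> M" "y \<in> M" for x y using that by blast
  have low: "min (d x y) (1 / (1 + d m x)) \<le> Inf (S x y)" if "x \<in> M" "y \<in> M" for x y
    using that bnd by (intro cInf_greatest ne) (auto simp: S_def chains_def)
  have rev: "S x y \<subseteq> S y x" for x y
  proof
    fix s assume "s \<in> S x y"
    then obtain n c where nc: "s = (\<Sum>i=1..n. ?\<delta> (c (i - 1)) (c i))" "1 \<le> n" "c \<in> chains n x y"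
      unfolding S_def by blast
    have "s = (\<Sum>i=1..n. ?\<delta> (c (n - (i - 1))) (c (n - i)))"
      unfolding nc(1)
    proof (rule sum.reindex_bij_witness[of _ "\<lambda>i. n + 1 - i" "\<lambda>i. n + 1 - i"])
      fix i assume "i \<in> {1..n}"
      then have "c (i - 1) \<in> M" "c i \<in> M" "n - (n + 1 - i) = i - 1" "n - (n + 1 - i - 1) = i"
        using nc(3) by (auto simp: chains_def)
      then show "?\<delta> (c (n - (n + 1 - i - 1))) (c (n - (n + 1 - i))) = ?\<delta> (c (i - 1)) (c i)"
        using dsym by metis
    qed auto
    moreover have "(\<lambda>i. c (n - i)) \<in> chains n y x"
      using nc(3) by (auto simp: chains_def)
    ultimately show "s \<in> S y x"
      using SI[of n "\<lambda>i. c (n - i)" y x] nc(2) by (simp only:)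
  qed
  have cat: "s + t \<in> S x z" if s: "s \<in> S x y" and t: "t \<in> S y z" for s t x y z
  proof -
    obtain n c where nc: "s = (\<Sum>i=1..n. ?\<delta> (c (i - 1)) (c i))" "1 \<le> n" "c \<in> chains n x y"
      using s unfolding S_def by blast
    obtain k e where ke: "t = (\<Sum>i=1..k. ?\<delta> (e (i - 1)) (e i))" "1 \<le> k" "e \<in> chains k y z"
      using t unfolding S_def by blast
    define f where "f i = (if i \<le> n then c i else e (i - n))" for i
    have fe: "f (n + i) = e i" for i
      using nc(3) ke(3) by (auto simp: f_def chains_def)
    have "(\<Sum>i=1..n+k. ?\<delta> (f (i - 1)) (f i)) =
        (\<Sum>i=1..n. ?\<delta> (f (i - 1)) (f i)) + (\<Sum>i=n+1..n+k. ?\<delta> (f (i - 1)) (f i))"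
      by (rule sum.ub_add_nat) simp
    also have "(\<Sum>i=1..n. ?\<delta> (f (i - 1)) (f i)) = s"
      unfolding nc(1) by (intro sum.cong) (auto simp: f_def)
    also have "(\<Sum>i=n+1..n+k. ?\<delta> (f (i - 1)) (f i)) = t"
      unfolding ke(1)
    proof (rule sum.reindex_bij_witness[of _ "\<lambda>i. n + i" "\<lambda>i. i - n"])
      fix i assume i: "i \<in> {n+1..n+k}"
      have "f (i - 1) = e (i - n - 1)" "f i = e (i - n)"
        using fe[of "i - n - 1"] fe[of "i - n"] i by auto
      then show "?\<delta> (e (i - n - 1)) (e (i - n)) = ?\<delta> (f (i - 1)) (f i)" by simp
    qed auto
    moreover have "f \<in> chains (n + k) x z"
    proof -
      have "f i \<in> M" if "i \<le> n + k" for i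
        using that nc(3) ke(3) by (auto simp: f_def chains_def Pi_iff)
      then show ?thesis using nc ke fe[of k] by (auto simp: chains_def f_def)
    qed
    ultimately show ?thesis using SI[of "n + k" f x z] nc(2) by simp
  qed
  show ?thesis
  proof
    show "0 \<le> dist_phi \<phi> m x y" for x y
      using Snn ne eq by (cases "x \<in> M \<and> y \<in> M") (auto intro!: cInf_greatest simp: dist_phi_def)
    show "dist_phi \<phi> m x y = dist_phi \<phi> m y x" for x y
      using rev[of x y] rev[of y x] eq by (cases "x \<in> M \<and> y \<in> M") (auto simp: dist_phi_def)
  next
    fix x y assume xy: "x \<in> M" "y \<in> M"
    show "dist_phi \<phi> m x y = 0 \<longleftrightarrow> x = y"
    proof
      assume 0: "dist_phi \<phi> m x y = 0"
      have "0 < 1 / (1 + d m x)" by (smt (verit) nonneg divide_pos_pos)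
      then have "d x y \<le> 0" using 0 low[OF xy] eq[OF xy] by linarith
      then show "x = y" using xy by (metis mdist_pos_eq not_less)
    next
      assume "x = y"
      then have "Inf (S x y) \<le> 0" using Sd[OF xy] d0[OF xy(1)] bdd cInf_lower by fastforce
      moreover have "0 \<le> Inf (S x y)" using Snn ne[OF xy] by (intro cInf_greatest) auto
      ultimately show "dist_phi \<phi> m x y = 0" using eq[OF xy] by simp
    qed
  next
    fix x y z assume M: "x \<in> M" "y \<in> M" "z \<in> M"
    have "Inf (S x z) - s \<le> Inf (S y z)" if "s \<in> S x y" for s
      by (intro cInf_greatest ne M) (smt (verit) cInf_lower[OF _ bdd] cat[OF that])
    then have "Inf (S x z) - Inf (S y z) \<le> Inf (S x y)"
      by (intro cInf_greatest ne M) (smt (verit))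
    then show "dist_phi \<phi> m x z \<le> dist_phi \<phi> m x y + dist_phi \<phi> m y z"
      using eq M by simp
  qed
qed

lemma equiv_Cauchy_equiv: "equiv {\<sigma>. MCauchy \<sigma>} Cauchy_equiv"
proof (rule equivI)
  show "Cauchy_equiv \<subseteq> {\<sigma>. MCauchy \<sigma>} \<times> {\<sigma>. MCauchy \<sigma>}"
    by (auto simp: Cauchy_equiv_def)
  show "refl_on {\<sigma>. MCauchy \<sigma>} Cauchy_equiv"
    by (auto simp: refl_on_def Cauchy_equiv_def MCauchy_def image_subset_iff)
  show "sym Cauchy_equiv"
    by (auto simp: sym_def Cauchy_equiv_def commute)
  show "trans Cauchy_equiv"
  proof (rule transI)
    fix \<rho> \<sigma> \<tau> assume *: "(\<rho>, \<sigma>) \<in> Cauchy_equiv" "(\<sigma>, \<tau>) \<in> Cauchy_equiv"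
    then have r: "\<rho> n \<in> M" "\<sigma> n \<in> M" "\<tau> n \<in> M" for n
      by (auto simp: Cauchy_equiv_def MCauchy_def)
    have "(\<lambda>n. d (\<rho> n) (\<sigma> n) + d (\<sigma> n) (\<tau> n)) \<longlonglongrightarrow> 0 + 0"
      using * by (intro tendsto_add) (auto simp: Cauchy_equiv_def)
    then have "(\<lambda>n. d (\<rho> n) (\<tau> n)) \<longlonglongrightarrow> 0"
      by (intro tendsto_sandwich[of "\<lambda>_. 0" "\<lambda>n. d (\<rho> n) (\<tau> n)" sequentially
            "\<lambda>n. d (\<rho> n) (\<sigma> n) + d (\<sigma> n) (\<tau> n)"]) (auto intro!: always_eventually triangle r)
    then show "(\<rho>, \<tau>) \<in> Cauchy_equiv" using * by (auto simp: Cauchy_equiv_def)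
  qed
qed

lemma completion_dist_LIMSEQ:
  assumes A: "A \<in> completion_carrier" "\<sigma> \<in> A" and B: "B \<in> completion_carrier" "\<tau> \<in> B"
  shows "(\<lambda>n. d (\<sigma> n) (\<tau> n)) \<longlonglongrightarrow> completion_dist A B"
proof -
  have cau: "MCauchy \<sigma>'" if "\<sigma>' \<in> A" "A \<in> completion_carrier" for \<sigma>' A
    using that in_quotient_imp_subset[OF equiv_Cauchy_equiv] unfolding completion_carrier_def by blast
  have inM: "\<sigma>' n \<in> M" if "MCauchy \<sigma>'" for \<sigma>' n using that by (auto simp: MCauchy_def)
  have q: "d (\<sigma> i) (\<tau> i) - d (\<sigma>' j) (\<tau>' j) \<le> d (\<sigma> i) (\<sigma>' j) + d (\<tau> i) (\<tau>' j)"
    if c: "MCauchy \<sigma>" "MCauchy \<tau>" "MCauchy \<sigma>'" "MCauchy \<tau>'" for \<sigma> \<tau> \<sigma>' \<tau>' i j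
    using triangle[OF inM[OF c(1), of i] inM[OF c(3), of j] inM[OF c(2), of i]]
      triangle'[OF inM[OF c(3), of j] inM[OF c(4), of j] inM[OF c(2), of i]] by linarith
  have c: "MCauchy \<sigma>" "MCauchy \<tau>" using assms cau by auto
  have "Cauchy (\<lambda>n. d (\<sigma> n) (\<tau> n))"
    unfolding Cauchy_def
  proof (intro allI impI)
    fix e :: real assume "0 < e"
    then have e: "0 < e/2" by simp
    obtain N1 where N1: "\<And>n n'. N1 \<le> n \<Longrightarrow> N1 \<le> n' \<Longrightarrow> d (\<sigma> n) (\<sigma> n') < e/2"
      using c(1) e unfolding MCauchy_def by blast
    obtain N2 where N2: "\<And>n n'. N2 \<le> n \<Longrightarrow> N2 \<le> n' \<Longrightarrow> d (\<tau> n) (\<tau> n') < e/2"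
      using c(2) e unfolding MCauchy_def by blast
    have "dist (d (\<sigma> i) (\<tau> i)) (d (\<sigma> j) (\<tau> j)) < e" if "i \<ge> max N1 N2" "j \<ge> max N1 N2" for i j
      using N1[of i j] N2[of i j] N1[of j i] N2[of j i] that
        q[OF c(1) c(2) c(1) c(2), of i j] q[OF c(1) c(2) c(1) c(2), of j i]
      by (simp add: dist_real_def)
    then show "\<exists>N. \<forall>i\<ge>N. \<forall>j\<ge>N. dist (d (\<sigma> i) (\<tau> i)) (d (\<sigma> j) (\<tau> j)) < e" by blast
  qed
  then obtain r where r: "(\<lambda>n. d (\<sigma> n) (\<tau> n)) \<longlonglongrightarrow> r"
    using Cauchy_convergent convergent_def by blast
  have all: "(\<lambda>n. d (\<sigma>' n) (\<tau>' n)) \<longlonglongrightarrow> r" if "\<sigma>' \<in> A" "\<tau>' \<in> B" for \<sigma>' \<tau>'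
  proof -
    have c': "MCauchy \<sigma>'" "MCauchy \<tau>'" using assms that cau by auto
    have "(\<sigma>, \<sigma>') \<in> Cauchy_equiv" "(\<tau>, \<tau>') \<in> Cauchy_equiv"
      using assms that quotient_eq_iff[OF equiv_Cauchy_equiv] unfolding completion_carrier_def by blast+
    then have "(\<lambda>n. d (\<sigma> n) (\<sigma>' n) + d (\<tau> n) (\<tau>' n)) \<longlonglongrightarrow> 0 + 0"
      by (intro tendsto_add) (auto simp: Cauchy_equiv_def)
    then have z: "(\<lambda>n. d (\<sigma> n) (\<sigma>' n) + d (\<tau> n) (\<tau>' n)) \<longlonglongrightarrow> 0" by simp
    have "(\<lambda>n. d (\<sigma>' n) (\<tau>' n) - d (\<sigma> n) (\<tau> n)) \<longlonglongrightarrow> 0"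
    proof (rule Lim_null_comparison[OF _ z], rule always_eventually, rule allI)
      fix n
      show "norm (d (\<sigma>' n) (\<tau>' n) - d (\<sigma> n) (\<tau> n)) \<le> d (\<sigma> n) (\<sigma>' n) + d (\<tau> n) (\<tau>' n)"
        using q[OF c(1) c(2) c'(1) c'(2), of n n] q[OF c'(1) c'(2) c(1) c(2), of n n]
        by (simp add: commute abs_le_iff)
    qed
    from tendsto_add[OF this r] show ?thesis by simp
  qed
  have "(THE r. \<forall>\<sigma>\<in>A. \<forall>\<tau>\<in>B. (\<lambda>n. d (\<sigma> n) (\<tau> n)) \<longlonglongrightarrow> r) = r"
    using all assms by (intro the_equality) (blast, meson LIMSEQ_unique)
  then show ?thesis using r assms by (simp add: completion_dist_def)
qed

lemma Metric_space_completion: "Metric_space completion_carrier completion_dist"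
proof -
  have rep: "\<exists>\<sigma>. \<sigma> \<in> A \<and> (\<forall>n. \<sigma> n \<in> M)" if A: "A \<in> completion_carrier" for A
  proof -
    obtain \<sigma> where "\<sigma> \<in> A"
      using A in_quotient_imp_non_empty[OF equiv_Cauchy_equiv] unfolding completion_carrier_def by blast
    moreover have "MCauchy \<sigma>"
      using A \<open>\<sigma> \<in> A\<close> in_quotient_imp_subset[OF equiv_Cauchy_equiv]
      unfolding completion_carrier_def by blast
    ultimately show ?thesis by (auto simp: MCauchy_def)
  qed
  note L = completion_dist_LIMSEQ
  show ?thesis
  proof
    fix A B
    show "0 \<le> completion_dist A B"
    proof (cases "A \<in> completion_carrier \<and> B \<in> completion_carrier")
      case True
      then obtain \<sigma> \<tau> where "\<sigma> \<in> A" "\<tau> \<in> B" using rep by meson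
      then have "(\<lambda>n. d (\<sigma> n) (\<tau> n)) \<longlonglongrightarrow> completion_dist A B" using L True by blast
      then show ?thesis by (rule LIMSEQ_le_const) auto
    next
      case False
      then show ?thesis by (auto simp: completion_dist_def)
    qed
    show "completion_dist A B = completion_dist B A"
    proof (cases "A \<in> completion_carrier \<and> B \<in> completion_carrier")
      case True
      then obtain \<sigma> \<tau> where "\<sigma> \<in> A" "\<tau> \<in> B" using rep by meson
      then have "(\<lambda>n. d (\<sigma> n) (\<tau> n)) \<longlonglongrightarrow> completion_dist A B"
          "(\<lambda>n. d (\<tau> n) (\<sigma> n)) \<longlonglongrightarrow> completion_dist B A" using L True by blast+
      then show ?thesis by (simp add: commute LIMSEQ_unique)
    next
      case False
      then show ?thesis by (auto simp: completion_dist_def)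
    qed
  next
    fix A B assume AB: "A \<in> completion_carrier" "B \<in> completion_carrier"
    then obtain \<sigma> \<tau> where st: "\<sigma> \<in> A" "\<tau> \<in> B" using rep by meson
    have lim: "(\<lambda>n. d (\<sigma> n) (\<tau> n)) \<longlonglongrightarrow> completion_dist A B" using L AB st by blast
    have "MCauchy \<sigma>" "MCauchy \<tau>"
      using AB st in_quotient_imp_subset[OF equiv_Cauchy_equiv]
      unfolding completion_carrier_def by blast+
    then have "A = B \<longleftrightarrow> (\<lambda>n. d (\<sigma> n) (\<tau> n)) \<longlonglongrightarrow> 0"
      using AB st quotient_eq_iff[OF equiv_Cauchy_equiv, of A B \<sigma> \<tau>]
      unfolding completion_carrier_def by (auto simp: Cauchy_equiv_def)
    then show "completion_dist A B = 0 \<longleftrightarrow> A = B" using lim LIMSEQ_unique by metis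
  next
    fix A B C
    assume ABC: "A \<in> completion_carrier" "B \<in> completion_carrier" "C \<in> completion_carrier"
    then obtain \<rho> \<sigma> \<tau> where r: "\<rho> \<in> A" "\<And>n. \<rho> n \<in> M" and s: "\<sigma> \<in> B" "\<And>n. \<sigma> n \<in> M"
      and t: "\<tau> \<in> C" "\<And>n. \<tau> n \<in> M" using rep by meson
    have "(\<lambda>n. d (\<rho> n) (\<sigma> n) + d (\<sigma> n) (\<tau> n)) \<longlonglongrightarrow> completion_dist A B + completion_dist B C"
      using L ABC r s t by (intro tendsto_add) blast+
    moreover have "(\<lambda>n. d (\<rho> n) (\<tau> n)) \<longlonglongrightarrow> completion_dist A C" using L ABC r t by blast
    ultimately show "completion_dist A C \<le> completion_dist A B + completion_dist B C"
      by (rule tendsto_le[OF sequentially_bot]) (simp add: triangle r s t)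
  qed
qed

end

end

theory Submission
  imports Defs
begin

text \<open>The argument has two independent halves.

  The first half is that \<open>d\<close> and \<open>dist_phi \<phi> m\<close> induce the same topology on \<open>M\<close>. The chain with a
  single link gives \<open>dist_phi \<phi> m x y \<le> d x y\<close>. In the other direction, every shortcut leaving a
  point \<open>u\<close> costs at least \<open>1 / (1 + d m u)\<close>, and getting from \<open>x\<close> to \<open>u\<close> together with that cost is
  at least \<open>1 / (1 + d m x)\<close>, since \<open>u \<mapsto> 1 / (1 + d m u)\<close> is 1-Lipschitz. Hence
  \<open>min (d x y) (1 / (1 + d m x)) \<le> dist_phi \<phi> m x y\<close> (lemma \<open>min_dist_le_dist_phi\<close>): below the
  threshold \<open>1 / (1 + d m x)\<close>, which depends on \<open>x\<close> only, a small distance in \<open>dist_phi \<phi> m\<close> forces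
  a small distance in \<open>d\<close>.

  The second half is general: the completion of a totally bounded metric space compactifies it.
  The canonical map is an isometry, hence an embedding, and a Cauchy sequence converges to its own
  class, so the image is dense. For compactness, a sequence of classes is approximated by a
  sequence of points of \<open>M\<close> at distances tending to \<open>0\<close>; total boundedness yields a Cauchy
  subsequence of these points, and the corresponding subsequence of classes converges to the class
  of that subsequence.\<close>

context Metric_space
begin

section \<open>The topology of the shortcut metric\<close>

text \<open>Telescoping along a chain. This is the one place where a lower bound for the infimum is
  established; it is later applied to a truncated distance from a point.\<close>

lemma dist_phi_ge_diff:
  assumes f: "\<And>u v. \<lbrakk>u \<in> M; v \<in> M\<rbrakk> \<Longrightarrow> f v - f u \<le> delta_phi \<phi> m u v"
    and xy: "x \<in> M" "y \<in> M"
  shows "f y - f x \<le> dist_phi \<phi> m x y"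
proof -
  let ?S = "{\<Sum>i=1..n. delta_phi \<phi> m (c (i - 1)) (c i) | n c. 1 \<le> n \<and> c \<in> chains n x y}"
  have tele: "f (c n) - f (c 0) \<le> (\<Sum>i=1..n. delta_phi \<phi> m (c (i - 1)) (c i))"
    if "c \<in> {..n} \<rightarrow> M" for c and n :: nat
    using that
  proof (induction n)
    case 0
    then show ?case by simp
  next
    case (Suc n)
    then have "c \<in> {..n} \<rightarrow> M" "c n \<in> M" "c (Suc n) \<in> M" by auto
    then show ?case using Suc.IH f[of "c n" "c (Suc n)"] by simp
  qed
  have "(\<lambda>i. if i = 0 then x else y) \<in> chains 1 x y"
    using xy by (auto simp: chains_def)
  then have "?S \<noteq> {}" by blast
  then have "f y - f x \<le> Inf ?S"
    by (rule cInf_greatest) (use tele in \<open>auto simp: chains_def\<close>)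
  then show ?thesis using xy by (simp add: dist_phi_def)
qed

lemma dist_phi_le:
  assumes pos: "\<And>x y. \<lbrakk>x \<in> M; y \<in> M\<rbrakk> \<Longrightarrow> 0 \<le> \<phi> x y"
    and xy: "x \<in> M" "y \<in> M"
  shows "dist_phi \<phi> m x y \<le> d x y"
proof -
  let ?S = "{\<Sum>i=1..n. delta_phi \<phi> m (c (i - 1)) (c i) | n c. 1 \<le> n \<and> c \<in> chains n x y}"
  have dpos: "0 \<le> delta_phi \<phi> m u v" if "u \<in> M" "v \<in> M" for u v
    using pos[OF that] by (simp add: delta_phi_def)
  have "bdd_below ?S"
    by (rule bdd_belowI[of _ 0]) (auto simp: chains_def Pi_iff intro!: sum_nonneg dpos)
  moreover have "delta_phi \<phi> m x y \<in> ?S"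
    by (rule CollectI, rule exI[of _ 1], rule exI[of _ "\<lambda>i. if i = 0 then x else y"])
      (use xy in \<open>auto simp: chains_def\<close>)
  ultimately have "Inf ?S \<le> delta_phi \<phi> m x y" by (rule cInf_lower[rotated])
  also have "\<dots> \<le> d x y" by (simp add: delta_phi_def)
  finally show ?thesis using xy by (simp add: dist_phi_def)
qed

lemma inverse_dist_Lipschitz:
  assumes "m \<in> M" "x \<in> M" "u \<in> M"
  shows "1 / (1 + d m x) \<le> d x u + 1 / (1 + d m u)"
proof -
  define a b t where "a = d m x" and "b = d m u" and "t = d x u"
  have ab: "0 \<le> a" "0 \<le> b" "0 \<le> t" "b \<le> a + t"
    using triangle[OF assms] by (auto simp: a_def b_def t_def)
  have "1 * 1 \<le> (1 + a) * (1 + b)" using ab by (intro mult_mono) auto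
  then have "t * 1 \<le> t * ((1 + a) * (1 + b))" using ab(3) by (intro mult_left_mono) auto
  then have "1 + b \<le> t * ((1 + a) * (1 + b)) + (1 + a)" using ab by linarith
  then have "1 / (1 + a) \<le> t + 1 / (1 + b)" using ab by (simp add: field_simps)
  then show ?thesis by (simp add: a_def b_def t_def)
qed

text \<open>The distance from \<open>x\<close>, truncated at \<open>1 / (1 + d m x)\<close>, grows along a link by at most the cost
  of the link. For a direct link this is the triangle inequality. For a shortcut from \<open>u\<close>,
  the summand \<open>1 / (1 + d m u)\<close> of its cost alone reaches from \<open>d x u\<close> up to the truncation level.\<close>

lemma min_dist_le_dist_phi:
  assumes m: "m \<in> M"
    and pos: "\<And>x y. \<lbrakk>x \<in> M; y \<in> M\<rbrakk> \<Longrightarrow> 0 \<le> \<phi> x y"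
    and xy: "x \<in> M" "y \<in> M"
  shows "min (d x y) (1 / (1 + d m x)) \<le> dist_phi \<phi> m x y"
proof -
  define f where "f u = min (d x u) (1 / (1 + d m x))" for u
  have "f v - f u \<le> delta_phi \<phi> m u v" if uv: "u \<in> M" "v \<in> M" for u v
  proof -
    have "f v - f u \<le> d u v"
      using triangle[OF xy(1) uv] nonneg[of u v] unfolding f_def by linarith
    moreover have "f v - f u \<le> 1 / (1 + d m u)"
    proof -
      have "0 \<le> 1 / (1 + d m u)" by simp
      then show ?thesis
        using inverse_dist_Lipschitz[OF m xy(1) uv(1)] unfolding f_def by linarith
    qed
    moreover have "0 \<le> 1 / (1 + d m v)" by simp
    ultimately show ?thesis using pos[OF uv] unfolding delta_phi_def by linarith
  qed
  then have "f y - f x \<le> dist_phi \<phi> m x y" by (rule dist_phi_ge_diff[OF _ xy])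
  moreover have "f x = 0" using xy by (simp add: f_def)
  ultimately show ?thesis by (simp add: f_def)
qed

lemma mtopology_dist_phi:
  assumes m: "m \<in> M"
    and pos: "\<And>x y. \<lbrakk>x \<in> M; y \<in> M\<rbrakk> \<Longrightarrow> 0 \<le> \<phi> x y"
    and sym: "\<And>x y. \<lbrakk>x \<in> M; y \<in> M\<rbrakk> \<Longrightarrow> \<phi> x y = \<phi> y x"
  shows "Metric_space.mtopology M (dist_phi \<phi> m) = mtopology"
proof -
  interpret D: Metric_space M "dist_phi \<phi> m"
    using m pos sym by (rule Metric_space_dist_phi)
  have "mball x r \<subseteq> D.mball x r" for x r
    using dist_phi_le[OF pos, where m = m] by fastforce
  moreover have "\<exists>s>0. D.mball x s \<subseteq> mball x r" if "x \<in> M" "r > 0" for x r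
  proof (intro exI conjI)
    let ?s = "min r (1 / (1 + d m x))"
    have "0 < 1 / (1 + d m x)" by (smt (verit) nonneg divide_pos_pos)
    then show "?s > 0" using that by simp
    have "d x y < r" if "y \<in> M" "dist_phi \<phi> m x y < ?s" for y
      using min_dist_le_dist_phi[where \<phi> = \<phi>, OF m pos \<open>x \<in> M\<close> that(1)] that(2) by linarith
    then show "D.mball x ?s \<subseteq> mball x r" by auto
  qed
  ultimately have "openin D.mtopology U \<longleftrightarrow> openin mtopology U" for U
    unfolding D.openin_mtopology openin_mtopology by (meson subset_iff subset_trans)
  then show ?thesis by (simp add: topology_eq)
qed


section \<open>The completion of a totally bounded space\<close>

lemma MCauchy_const: "x \<in> M \<Longrightarrow> MCauchy (\<lambda>_. x)"
  by (auto simp: MCauchy_def)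

lemma Cauchy_class:
  assumes "MCauchy \<sigma>"
  shows "Cauchy_equiv `` {\<sigma>} \<in> completion_carrier" "\<sigma> \<in> Cauchy_equiv `` {\<sigma>}"
  using assms equiv_class_self[OF equiv_Cauchy_equiv, of \<sigma>]
  by (auto simp: completion_carrier_def intro: quotientI)

lemma completion_carrierE:
  assumes "A \<in> completion_carrier"
  obtains \<sigma> where "MCauchy \<sigma>" "A = Cauchy_equiv `` {\<sigma>}"
  using assms unfolding completion_carrier_def by (auto elim: quotientE)

lemma completion_emb_in: "x \<in> M \<Longrightarrow> completion_emb x \<in> completion_carrier"
  unfolding completion_emb_def by (intro Cauchy_class MCauchy_const)

lemma completion_dist_emb:
  assumes "x \<in> M" "y \<in> M"
  shows "completion_dist (completion_emb x) (completion_emb y) = d x y"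
proof -
  have "(\<lambda>n::nat. d x y) \<longlonglongrightarrow> completion_dist (completion_emb x) (completion_emb y)"
    using completion_dist_LIMSEQ[OF Cauchy_class Cauchy_class] MCauchy_const assms
    unfolding completion_emb_def by blast
  then show ?thesis by (simp add: LIMSEQ_const_iff)
qed

text \<open>Both density and compactness come from this: the distance from \<open>\<sigma> n\<close> to the class of \<open>\<sigma>\<close> is
  the limit of \<open>d (\<sigma> n) (\<sigma> k)\<close> in \<open>k\<close>, which the Cauchy condition makes small.\<close>

lemma Cauchy_limitin_class:
  assumes "MCauchy \<sigma>"
  shows "limitin (Metric_space.mtopology completion_carrier completion_dist)
           (\<lambda>n. completion_emb (\<sigma> n)) (Cauchy_equiv `` {\<sigma>}) sequentially"
proof -
  interpret C: Metric_space completion_carrier completion_dist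
    by (rule Metric_space_completion)
  have M: "\<sigma> n \<in> M" for n using assms by (auto simp: MCauchy_def)
  have "\<exists>N. \<forall>n\<ge>N. completion_dist (completion_emb (\<sigma> n)) (Cauchy_equiv `` {\<sigma>}) < e"
    if "e > 0" for e
  proof -
    obtain N where N: "\<And>n k. \<lbrakk>N \<le> n; N \<le> k\<rbrakk> \<Longrightarrow> d (\<sigma> n) (\<sigma> k) < e / 2"
      using assms \<open>e > 0\<close> unfolding MCauchy_def by (meson half_gt_zero)
    have "completion_dist (completion_emb (\<sigma> n)) (Cauchy_equiv `` {\<sigma>}) \<le> e / 2" if "N \<le> n" for n
    proof (rule LIMSEQ_le_const2)
      show "(\<lambda>k. d (\<sigma> n) (\<sigma> k)) \<longlonglongrightarrow> completion_dist (completion_emb (\<sigma> n)) (Cauchy_equiv `` {\<sigma>})"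
        using completion_dist_LIMSEQ[OF Cauchy_class Cauchy_class] MCauchy_const[OF M] assms
        unfolding completion_emb_def by blast
      show "\<exists>K. \<forall>k\<ge>K. d (\<sigma> n) (\<sigma> k) \<le> e / 2" using N[OF that] less_imp_le by blast
    qed
    then show ?thesis using \<open>e > 0\<close> by (intro exI[of _ N]) fastforce
  qed
  then show ?thesis
    unfolding C.limit_metric_sequentially
    using Cauchy_class(1)[OF assms] completion_emb_in[OF M] by blast
qed

lemma embedding_map_completion_emb:
  "embedding_map mtopology (Metric_space.mtopology completion_carrier completion_dist) completion_emb"
proof -
  interpret MC: Metric_space12 M d completion_carrier completion_dist
    by (intro Metric_space12.intro Metric_space_completion Metric_space_axioms)
  show ?thesis
    using completion_emb_in completion_dist_emb by (intro MC.isometry_imp_embedding_map) auto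
qed

lemma completion_emb_approx:
  assumes "A \<in> completion_carrier" "e > 0"
  shows "\<exists>x\<in>M. completion_dist (completion_emb x) A < e"
proof -
  interpret C: Metric_space completion_carrier completion_dist
    by (rule Metric_space_completion)
  obtain \<sigma> where \<sigma>: "MCauchy \<sigma>" "A = Cauchy_equiv `` {\<sigma>}"
    using assms(1) by (rule completion_carrierE)
  then obtain N where "completion_dist (completion_emb (\<sigma> N)) A < e"
    using Cauchy_limitin_class[OF \<sigma>(1)] assms(2) unfolding C.limit_metric_sequentially by blast
  moreover have "\<sigma> N \<in> M" using \<sigma>(1) by (auto simp: MCauchy_def)
  ultimately show ?thesis by blast
qed

lemma completion_emb_dense:
  "Metric_space.mtopology completion_carrier completion_dist closure_of (completion_emb ` M)
     = completion_carrier"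
proof -
  interpret C: Metric_space completion_carrier completion_dist
    by (rule Metric_space_completion)
  show ?thesis
    unfolding C.metric_closure_of
    using completion_emb_approx completion_emb_in C.commute by fastforce
qed

lemma compact_space_completion:
  assumes "mtotally_bounded M"
  shows "compact_space (Metric_space.mtopology completion_carrier completion_dist)"
proof -
  interpret C: Metric_space completion_carrier completion_dist
    by (rule Metric_space_completion)
  show ?thesis
    unfolding C.compact_space_sequentially
  proof (intro allI impI)
    fix A :: "nat \<Rightarrow> (nat \<Rightarrow> 'a) set" assume "range A \<subseteq> completion_carrier"
    then have A: "A n \<in> completion_carrier" for n by auto
    have "\<exists>x\<in>M. completion_dist (completion_emb x) (A n) < 1 / Suc n" for n
      by (rule completion_emb_approx[OF A]) simp
    then obtain \<sigma> where \<sigma>: "\<And>n. \<sigma> n \<in> M"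
        "\<And>n. completion_dist (completion_emb (\<sigma> n)) (A n) < 1 / Suc n" by metis
    obtain r where r: "strict_mono r" "MCauchy (\<sigma> \<circ> r)"
      using assms \<sigma>(1) unfolding mtotally_bounded_sequentially by (meson image_subsetI)
    define L where "L = Cauchy_equiv `` {\<sigma> \<circ> r}"
    have L: "L \<in> completion_carrier" unfolding L_def by (rule Cauchy_class[OF r(2)])
    let ?E = "\<lambda>n. completion_emb (\<sigma> (r n))"
    have lim: "(\<lambda>n. completion_dist (?E n) L) \<longlonglongrightarrow> 0"
      using Cauchy_limitin_class[OF r(2)] by (simp add: C.limitin_metric_dist_null L_def o_def)
    have near: "(\<lambda>n. 1 / real (Suc (r n))) \<longlonglongrightarrow> 0"
      using LIMSEQ_subseq_LIMSEQ[OF LIMSEQ_inverse_real_of_nat r(1)]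
      by (simp add: o_def inverse_eq_divide)
    have "(\<lambda>n. completion_dist (A (r n)) L) \<longlonglongrightarrow> 0"
    proof (rule Lim_null_comparison[OF always_eventually])
      show "(\<lambda>n. 1 / real (Suc (r n)) + completion_dist (?E n) L) \<longlonglongrightarrow> 0"
        using tendsto_add[OF near lim] by simp
      have "completion_dist (A (r n)) L
          \<le> completion_dist (A (r n)) (?E n) + completion_dist (?E n) L" for n
        using A completion_emb_in[OF \<sigma>(1)] L by (rule C.triangle)
      then show "\<forall>n. norm (completion_dist (A (r n)) L)
          \<le> 1 / real (Suc (r n)) + completion_dist (?E n) L"
        using \<sigma>(2) C.commute by (smt (verit) C.nonneg real_norm_def)
    qed
    then have "limitin C.mtopology (A \<circ> r) L sequentially"
      using L A by (simp add: C.limitin_metric_dist_null)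
    then show "\<exists>l r. l \<in> completion_carrier \<and> strict_mono r \<and>
        limitin C.mtopology (A \<circ> r) l sequentially"
      using L r(1) by blast
  qed
qed

lemma compactification_completion:
  assumes "mtotally_bounded M"
  shows "compactification_via mtopology
    (Metric_space.mtopology completion_carrier completion_dist) completion_emb"
proof -
  interpret C: Metric_space completion_carrier completion_dist
    by (rule Metric_space_completion)
  show ?thesis
    unfolding compactification_via_def
    using compact_space_completion[OF assms] C.Hausdorff_space_mtopology
      embedding_map_completion_emb completion_emb_dense by simp
qed

end


section \<open>The compactification\<close>

theorem mainTheorem3:
  fixes X :: "'a set" and d :: "'a \<Rightarrow> 'a \<Rightarrow> real" and m :: 'a and \<phi> :: "'a \<Rightarrow> 'a \<Rightarrow> real"
  assumes "Metric_space X d"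
    and "m \<in> X"
    and "\<And>x y. \<lbrakk>x \<in> X; y \<in> X\<rbrakk> \<Longrightarrow> 0 \<le> \<phi> x y"
    and "\<And>x y. \<lbrakk>x \<in> X; y \<in> X\<rbrakk> \<Longrightarrow> \<phi> x y = \<phi> y x"
    and "Metric_space.mtotally_bounded X (Metric_space.dist_phi X d \<phi> m) X"
  shows "compactification_via
    (Metric_space.mtopology X d)
    (Metric_space.mtopology
      (Metric_space.completion_carrier X (Metric_space.dist_phi X d \<phi> m))
      (Metric_space.completion_dist X (Metric_space.dist_phi X d \<phi> m)))
    (Metric_space.completion_emb X (Metric_space.dist_phi X d \<phi> m))"
proof -
  interpret Metric_space X d by fact
  have "Metric_space X (dist_phi \<phi> m)"
    using assms(2-4) by (rule Metric_space_dist_phi)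
  from Metric_space.compactification_completion[OF this assms(5)] show ?thesis
    using mtopology_dist_phi[of m \<phi>] assms(2-4) by simp
qed

end
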